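(* Let $m,n\ge 2$ be integers. The monoid $G_{m,n}^{+}$ is cancellative; that is, for all $A,B,X,Y\in G_{m,n}^{+}$, if $AXB=AYB$ in $G_{m,n}^{+}$ then $X=Y$ in $G_{m,n}^{+}$.
   Context: For letters $x_1,\dots,x_k$, the symbol $[x_1,x_2,\dots,x_k]$ denotes the cyclic relations $x_1x_2\cdots x_k=x_2\cdots x_kx_1=x_3\cdots x_kx_1x_2=\cdots=x_kx_1\cdots x_{k-1}$ (all cyclic rotations of the word are equal); in particular $[x,y]$ denotes $xy=yx$. $G_{m,n}^{+}$ is the monoid presented (as a monoid) by the generators $s,t_1,\dots,t_m,u_1,\dots,u_n$ and the relations $[s,t_1,\dots,t_m]$, $[s,u_1,\dots,u_n]$, and $[t_i,u_j]$ for all $1\le i\le m$, $1\le j\le n$. *)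

theory Defs
  imports "HOL-Algebra.Group"
begin

text \<open>Presentations of monoids: the elements of the free monoid on \<open>X\<close> are the lists
  in \<open>lists X\<close>, and the monoid presented by generators \<open>X\<close> and relations \<open>R\<close> is the quotient
  by the smallest congruence containing \<open>R\<close>. The congruence only relates words over \<open>X\<close>.\<close>

inductive_set word_cong :: "'a set \<Rightarrow> ('a list \<times> 'a list) set \<Rightarrow> ('a list \<times> 'a list) set"
  for X :: "'a set" and R :: "('a list \<times> 'a list) set"
  where
    rel: "(u, v) \<in> R \<Longrightarrow> u \<in> lists X \<Longrightarrow> v \<in> lists X \<Longrightarrow> (u, v) \<in> word_cong X R"
  | refl: "u \<in> lists X \<Longrightarrow> (u, u) \<in> word_cong X R"
  | sym: "(u, v) \<in> word_cong X R \<Longrightarrow> (v, u) \<in> word_cong X R"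
  | trans: "(u, v) \<in> word_cong X R \<Longrightarrow> (v, w) \<in> word_cong X R \<Longrightarrow> (u, w) \<in> word_cong X R"
  | append: "(u, v) \<in> word_cong X R \<Longrightarrow> (u', v') \<in> word_cong X R \<Longrightarrow>
      (u @ u', v @ v') \<in> word_cong X R"

definition presented_monoid :: "'a set \<Rightarrow> ('a list \<times> 'a list) set \<Rightarrow> 'a list set monoid"
  where "presented_monoid X R =
    \<lparr>carrier = lists X // word_cong X R,
     mult = (\<lambda>P Q. \<Union>p\<in>P. \<Union>q\<in>Q. word_cong X R `` {p @ q}),
     one = word_cong X R `` {[]}\<rparr>"

lemma word_cong_in_lists:
  "(u, v) \<in> word_cong X R \<Longrightarrow> u \<in> lists X \<and> v \<in> lists X"
  by (induction rule: word_cong.induct) auto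

lemma equiv_word_cong: "equiv (lists X) (word_cong X R)"
proof (rule equivI)
  show "word_cong X R \<subseteq> lists X \<times> lists X"
    using word_cong_in_lists[of _ _ X R] by auto
  show "refl_on (lists X) (word_cong X R)"
    by (rule refl_onI) (rule word_cong.refl)
  show "sym (word_cong X R)"
    by (rule symI) (rule word_cong.sym)
  show "trans (word_cong X R)"
    by (rule transI) (rule word_cong.trans)
qed

lemma presented_monoid_mult_class:
  assumes "u \<in> lists X" "v \<in> lists X"
  shows "(word_cong X R `` {u}) \<otimes>\<^bsub>presented_monoid X R\<^esub> (word_cong X R `` {v}) =
    word_cong X R `` {u @ v}"
proof -
  have "word_cong X R `` {p @ q} = word_cong X R `` {u @ v}"
    if "(u, p) \<in> word_cong X R" "(v, q) \<in> word_cong X R" for p q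
    using equiv_class_eq[OF equiv_word_cong word_cong.append[OF that]] by simp
  moreover have "(u, u) \<in> word_cong X R" "(v, v) \<in> word_cong X R"
    using assms by (auto intro: word_cong.refl)
  ultimately have "(\<Union>p\<in>word_cong X R `` {u}. \<Union>q\<in>word_cong X R `` {v}. word_cong X R `` {p @ q})
      = word_cong X R `` {u @ v}"
    by blast
  then show ?thesis
    by (simp add: presented_monoid_def)
qed

lemma monoid_presented_monoid: "monoid (presented_monoid X R)"
proof -
  let ?G = "presented_monoid X R" and ?c = "\<lambda>u. word_cong X R `` {u}"
  have carrI: "?c u \<in> carrier ?G" if "u \<in> lists X" for u
    using that unfolding presented_monoid_def by (auto intro: quotientI)
  have carrE: "\<exists>u\<in>lists X. x = ?c u" if "x \<in> carrier ?G" for x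
    using that unfolding presented_monoid_def quotient_def by auto
  have one: "\<one>\<^bsub>?G\<^esub> = ?c []"
    by (simp add: presented_monoid_def)
  note mult = presented_monoid_mult_class[where X = X and R = R]
  show ?thesis
  proof
    fix x y assume "x \<in> carrier ?G" "y \<in> carrier ?G"
    then obtain u v where "u \<in> lists X" "x = ?c u" "v \<in> lists X" "y = ?c v"
      using carrE by meson
    then show "x \<otimes>\<^bsub>?G\<^esub> y \<in> carrier ?G"
      using carrI[of "u @ v"] mult[of u v] by simp
  next
    fix x y z assume "x \<in> carrier ?G" "y \<in> carrier ?G" "z \<in> carrier ?G"
    then obtain u v w where "u \<in> lists X" "x = ?c u" "v \<in> lists X" "y = ?c v"
        "w \<in> lists X" "z = ?c w"
      using carrE by meson
    then show "x \<otimes>\<^bsub>?G\<^esub> y \<otimes>\<^bsub>?G\<^esub> z = x \<otimes>\<^bsub>?G\<^esub> (y \<otimes>\<^bsub>?G\<^esub> z)"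
      using mult[of u v] mult[of v w] mult[of "u @ v" w] mult[of u "v @ w"] by simp
  next
    show "\<one>\<^bsub>?G\<^esub> \<in> carrier ?G"
      unfolding one by (rule carrI) simp
  next
    fix x assume "x \<in> carrier ?G"
    then obtain u where u: "u \<in> lists X" "x = ?c u"
      using carrE by meson
    show "\<one>\<^bsub>?G\<^esub> \<otimes>\<^bsub>?G\<^esub> x = x"
      using u mult[of "[]" u] by (simp add: one)
    show "x \<otimes>\<^bsub>?G\<^esub> \<one>\<^bsub>?G\<^esub> = x"
      using u mult[of u "[]"] by (simp add: one)
  qed
qed

text \<open>The cyclic relations \<open>[x\<^sub>1, \<dots>, x\<^sub>k]\<close>: the word is identified with each of its rotations.\<close>

definition cyclic_rels :: "'a list \<Rightarrow> ('a list \<times> 'a list) set"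
  where "cyclic_rels w = {(w, rotate i w) |i. i < length w}"

datatype gen = Gen_s | Gen_t nat | Gen_u nat

definition G_gens :: "nat \<Rightarrow> nat \<Rightarrow> gen set"
  where "G_gens m n = {Gen_s} \<union> Gen_t ` {1..m} \<union> Gen_u ` {1..n}"

definition G_rels :: "nat \<Rightarrow> nat \<Rightarrow> (gen list \<times> gen list) set"
  where "G_rels m n =
    cyclic_rels (Gen_s # map Gen_t [1..<Suc m]) \<union>
    cyclic_rels (Gen_s # map Gen_u [1..<Suc n]) \<union>
    (\<Union>i\<in>{1..m}. \<Union>j\<in>{1..n}. cyclic_rels [Gen_t i, Gen_u j])"

definition G_plus :: "nat \<Rightarrow> nat \<Rightarrow> gen list set monoid"
  where "G_plus m n = presented_monoid (G_gens m n) (G_rels m n)"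

end

theory Submission
  imports Defs
begin

text \<open>
  Deleting the letters \<open>u\<^sub>j\<close>, respectively the letters \<open>t\<^sub>i\<close>, maps \<open>G\<^sub>m\<^sub>,\<^sub>n\<^sup>+\<close> to the monoids presented by
  the single cyclic relation \<open>[s, t\<^sub>1, \<dots>, t\<^sub>m]\<close>, respectively \<open>[s, u\<^sub>1, \<dots>, u\<^sub>n]\<close>. These two maps are
  jointly injective: between two consecutive occurrences of \<open>s\<close> the \<open>t\<close>- and the \<open>u\<close>-letters commute,
  and a cyclic relation in the \<open>t\<close>-letters involves only one \<open>s\<close>, so the \<open>u\<close>-letters can be moved out
  of its way. It remains to see that the monoid of one cyclic relation \<open>[x\<^sub>1, \<dots>, x\<^sub>k]\<close> is cancellative.
  There \<open>\<Delta> = x\<^sub>1 \<cdots> x\<^sub>k\<close> is central and every letter divides it, so it suffices to cancel \<open>\<Delta>\<close>; and this is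
  possible because every element is uniquely \<open>\<Delta>\<^sup>k r\<close> with \<open>r\<close> a word without a rotation of
  \<open>x\<^sub>1 \<cdots> x\<^sub>k\<close> as a factor.
\<close>

section \<open>The monoid of one cyclic relation\<close>

lemma word_cong_context:
  assumes "(u, v) \<in> word_cong X R" "a \<in> lists X" "b \<in> lists X"
  shows "(a @ u @ b, a @ v @ b) \<in> word_cong X R"
  by (intro word_cong.append assms word_cong.refl)

section \<open>Rotations of a word\<close>

definition rotations :: "'a list \<Rightarrow> 'a list set"
  where "rotations w = range (\<lambda>i. rotate i w)"

lemma self_in_rotations: "w \<in> rotations w"
  unfolding rotations_def by (metis rangeI rotate0 id_apply)

lemma rotations_append_commute: "a @ b \<in> rotations w \<Longrightarrow> b @ a \<in> rotations w"
  unfolding rotations_def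
  by (clarsimp simp: image_iff) (metis rotate_append rotate_rotate)

lemma length_rotations: "z \<in> rotations w \<Longrightarrow> length z = length w"
  by (auto simp: rotations_def)

lemma set_rotations: "z \<in> rotations w \<Longrightarrow> set z = set w"
  by (auto simp: rotations_def)

text \<open>With distinct letters, the head of a rotation fixes its starting position modulo
  \<open>length w\<close>.\<close>

lemma rotations_eqI:
  assumes "distinct w" "z \<in> rotations w" "z' \<in> rotations w" "z \<noteq> []" "hd z = hd z'"
  shows "z = z'"
proof -
  obtain i j where ij: "z = rotate i w" "z' = rotate j w"
    using assms(2,3) by (auto simp: rotations_def)
  have "w \<noteq> []"
    using assms(4) ij by auto
  then have "w ! (i mod length w) = w ! (j mod length w)"
    using assms(5) ij by (simp add: hd_rotate_conv_nth)
  then have "i mod length w = j mod length w"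
    using assms(1) \<open>w \<noteq> []\<close> by (simp add: nth_eq_iff_index_eq)
  then show ?thesis
    using ij by (metis rotate_conv_mod)
qed

text \<open>Supplies the complement of a letter: \<open>x # v\<close> and \<open>v @ [x]\<close>
  both represent \<Delta>, so \<open>x\<close> divides \<Delta> on either side with the same
  cofactor.\<close>

lemma rotation_with_head:
  assumes "x \<in> set w"
  obtains v where "x # v \<in> rotations w" "v @ [x] \<in> rotations w"
proof -
  obtain a b where "w = a @ x # b"
    using assms by (meson split_list)
  then have "x # (b @ a) \<in> rotations w"
    using rotations_append_commute[of a "x # b" w] self_in_rotations[of w] by simp
  then show ?thesis
    using that rotations_append_commute[of "[x]" "b @ a" w] by simp
qed

text \<open>The pair \<open>(k, r)\<close> stands for \<open>\<Delta>\<^sup>k r\<close>, and \<open>push\<close> multiplies it by a letter on the left.\<close>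

fun push :: "'a list \<Rightarrow> 'a \<Rightarrow> nat \<times> 'a list \<Rightarrow> nat \<times> 'a list"
  where "push w x (k, r) = (if take (length w) (x # r) \<in> rotations w
    then (Suc k, drop (length w) (x # r)) else (k, x # r))"

text \<open>The test at \<open>i\<close> inspects the factor of length \<open>length w\<close>
  starting there. Past the end of \<open>r\<close> it is too short to be a rotation, so
  \<open>i\<close> needs no bound.\<close>

definition reduced :: "'a list \<Rightarrow> 'a list \<Rightarrow> bool"
  where "reduced w r \<longleftrightarrow> (\<forall>i. take (length w) (drop i r) \<notin> rotations w)"

lemma reduced_Nil: "w \<noteq> [] \<Longrightarrow> reduced w []"
  using length_rotations[of "[]" w] by (auto simp: reduced_def)

text \<open>Without a reduction the only new factor to inspect is the one at position 0, which
  \<open>push\<close> has just tested; with one, a suffix of the old word remains.\<close>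

lemma reduced_push: "reduced w (snd st) \<Longrightarrow> reduced w (snd (push w x st))"
  by (cases st) (auto simp: reduced_def drop_Cons split: nat.split)

lemma reduced_foldr_push: "reduced w (snd st) \<Longrightarrow> reduced w (snd (foldr (push w) u st))"
  by (induction u) (auto intro: reduced_push)

text \<open>A rotation of \<open>w\<close> is determined by its first letter, so a reduction would force the first letter
  of \<open>r\<close> to be \<open>h\<close>.\<close>

lemma foldr_push_no_reduction:
  assumes "distinct w" "q @ p @ h # e \<in> rotations w" "r = [] \<or> hd r \<noteq> h"
  shows "foldr (push w) q (k, p @ r) = (k, q @ p @ r)"
  using assms(2)
proof (induction q arbitrary: e)
  case Nil
  then show ?case by simp
next
  case (Cons x q)
  \<comment> \<open>Moving \<open>x\<close> to the end only lengthens \<open>e\<close>, so the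
    induction hypothesis applies to the shorter \<open>q\<close>.\<close>
  have "q @ p @ h # e @ [x] \<in> rotations w"
    using rotations_append_commute[of "[x]" "q @ p @ h # e" w] Cons.prems by simp
  then have IH: "foldr (push w) q (k, p @ r) = (k, q @ p @ r)"
    by (rule Cons.IH)
  have "take (length w) (x # q @ p @ r) \<notin> rotations w"
  proof
    assume rot: "take (length w) (x # q @ p @ r) \<in> rotations w"
    have len: "length w = Suc (length q + length p + Suc (length e))"
      using length_rotations[OF Cons.prems] by simp
    \<comment> \<open>Both sides are rotations with head \<open>x\<close>. Comparing what follows
      \<open>p\<close> then forces \<open>r\<close> to start with \<open>h\<close>.\<close>
    have "take (length w) (x # q @ p @ r) = x # q @ p @ h # e"
      by (rule rotations_eqI[OF assms(1) rot]) (use Cons.prems len in auto)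
    then have "take (Suc (length e)) r = h # e"
      by (simp add: len)
    then show False
      using assms(3) by (cases r) auto
  qed
  then show ?case
    by (simp add: IH)
qed

lemma longest_common_prefixE:
  obtains p q r' where "z = p @ q" "r = p @ r'" "q = [] \<or> r' = [] \<or> hd r' \<noteq> hd q"
proof -
  have "\<exists>p q r'. z = p @ q \<and> r = p @ r' \<and> (q = [] \<or> r' = [] \<or> hd r' \<noteq> hd q)"
  proof (induction z arbitrary: r)
    case Nil
    then show ?case by auto
  next
    case (Cons x z)
    show ?case
    proof (cases "r \<noteq> [] \<and> hd r = x")
      case True
      then obtain r1 where r1: "r = x # r1"
        by (cases r) auto
      obtain p q r' where "z = p @ q" "r1 = p @ r'" "q = [] \<or> r' = [] \<or> hd r' \<noteq> hd q"
        using Cons.IH[of r1] by blast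
      then show ?thesis
        using r1 by (intro exI[of _ "x # p"] exI[of _ q] exI[of _ r']) simp
    next
      case False
      then show ?thesis
        by (intro exI[of _ "[]"] exI[of _ "x # z"] exI[of _ r]) auto
    qed
  qed
  then show ?thesis
    using that by blast
qed

text \<open>Let \<open>p\<close> be the longest common prefix, \<open>z = p @ h # q'\<close> and
  \<open>r = p @ r'\<close>. Pushing \<open>q'\<close> reduces nothing; \<open>h\<close> completes
  the rotation \<open>h # q' @ p\<close>, which is removed and leaves \<open>r'\<close>; pushing
  \<open>p\<close> restores \<open>r\<close>. Exactly one reduction takes place.\<close>

lemma foldr_push_rotation:
  assumes "distinct w" "w \<noteq> []" "z \<in> rotations w" "reduced w r"
  shows "foldr (push w) z (k, r) = (Suc k, r)"
proof -
  obtain p q r' where pq: "z = p @ q" "r = p @ r'" "q = [] \<or> r' = [] \<or> hd r' \<noteq> hd q"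
    by (rule longest_common_prefixE)
  \<comment> \<open>Otherwise the reduced word \<open>r\<close> would begin with the rotation
    \<open>z\<close>.\<close>
  have "q \<noteq> []"
  proof
    assume "q = []"
    then have "take (length w) (drop 0 r) = z"
      using pq length_rotations[OF assms(3)] by simp
    then show False
      using assms(3,4) unfolding reduced_def by metis
  qed
  then obtain h q' where q: "q = h # q'"
    by (cases q) auto
  have r': "r' = [] \<or> hd r' \<noteq> h"
    using pq q by auto
  have pz: "p @ h # q' \<in> rotations w"
    using assms(3) pq q by simp
  have rot: "h # q' @ p \<in> rotations w"
    using rotations_append_commute[OF pz] by simp
  have len: "length w = Suc (length q' + length p)"
    using length_rotations[OF rot] by simp
  have "q' @ p @ [h] \<in> rotations w"
    using rotations_append_commute[of "[h]" "q' @ p" w] rot by simp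
  then have "foldr (push w) q' (k, p @ r') = (k, q' @ p @ r')"
    using foldr_push_no_reduction[OF assms(1) _ r'] by blast
  moreover have "push w h (k, q' @ p @ r') = (Suc k, r')"
    using rot len by simp
  moreover have "foldr (push w) p (Suc k, r') = (Suc k, p @ r')"
    using foldr_push_no_reduction[OF assms(1) _ r', of p "[]"] pz by simp
  ultimately show ?thesis
    by (simp add: pq q)
qed

text \<open>Pushing is an action of the presented monoid on pairs with reduced second component:
  both sides of a relation are rotations, and each rotation just raises the exponent by one.\<close>

lemma foldr_push_cong:
  assumes "distinct w" "w \<noteq> []" "(u, v) \<in> word_cong (set w) (cyclic_rels w)"
  shows "reduced w (snd st) \<Longrightarrow> foldr (push w) u st = foldr (push w) v st"
  using assms(3)
proof (induction arbitrary: st rule: word_cong.induct)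
  case (rel u v)
  then have "u \<in> rotations w" "v \<in> rotations w"
    using self_in_rotations by (auto simp: cyclic_rels_def rotations_def)
  then show ?case
    using rel.prems foldr_push_rotation[OF assms(1,2), of _ "snd st" "fst st"] by simp
qed (auto simp: reduced_foldr_push)

section \<open>The central element \<Delta> and normal forms\<close>

lemma rotations_cong:
  assumes "z \<in> rotations w"
  shows "(z, w) \<in> word_cong (set w) (cyclic_rels w)"
proof (cases "w = []")
  case True
  then show ?thesis
    using assms by (auto simp: rotations_def intro: word_cong.refl)
next
  case False
  obtain i where "z = rotate (i mod length w) w"
    using assms rotate_conv_mod by (auto simp: rotations_def)
  then have "(w, z) \<in> cyclic_rels w"
    using False by (auto simp: cyclic_rels_def)
  then show ?thesis
    using set_rotations[OF assms] by (intro word_cong.sym[OF word_cong.rel]) auto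
qed

text \<open>With \<open>v\<close> the cofactor of the letter \<open>x\<close>, and \<Delta> standing
  for \<open>w\<close>: \<open>x u \<Delta> ~ x \<Delta> u ~ x (v x) u = (x v) x u ~ \<Delta> x
  u\<close>.\<close>

lemma cyclic_word_central:
  assumes "u \<in> lists (set w)"
  shows "(u @ w, w @ u) \<in> word_cong (set w) (cyclic_rels w)"
  using assms
proof (induction u)
  case Nil
  then show ?case by (auto intro: word_cong.refl)
next
  case (Cons x u)
  let ?C = "word_cong (set w) (cyclic_rels w)"
  obtain v where v: "x # v \<in> rotations w" "v @ [x] \<in> rotations w"
    using Cons.hyps by (meson rotation_with_head)
  have x: "[x] \<in> lists (set w)" "[] \<in> lists (set w)"
    using Cons.hyps by auto
  have "([x] @ u @ w, [x] @ w @ u) \<in> ?C"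
    using word_cong_context[OF Cons.IH x] by simp
  moreover have "([x] @ w @ u, [x] @ (v @ [x]) @ u) \<in> ?C"
    by (rule word_cong_context[OF word_cong.sym[OF rotations_cong[OF v(2)]] x(1)])
      (use Cons.hyps in auto)
  moreover have "([] @ (x # v) @ x # u, [] @ w @ x # u) \<in> ?C"
    by (rule word_cong_context[OF rotations_cong[OF v(1)]]) (use Cons.hyps in auto)
  ultimately show ?case
    by (auto intro: word_cong.trans)
qed

text \<open>Soundness of reading \<open>(k, r)\<close> as \<open>\<Delta>\<^sup>k r\<close>: a new
  letter commutes past the power of \<Delta>, and a rotation then found in front of the rest is
  congruent to one more \<Delta>.\<close>

lemma foldr_push_normal_form:
  assumes "u \<in> lists (set w)" "foldr (push w) u (0, []) = (k, r)"
  shows "(u, concat (replicate k w) @ r) \<in> word_cong (set w) (cyclic_rels w)"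
  using assms
proof (induction u arbitrary: k r)
  case Nil
  then show ?case by (auto intro: word_cong.refl)
next
  case (Cons x u)
  let ?C = "word_cong (set w) (cyclic_rels w)"
  let ?D = "\<lambda>k. concat (replicate k w)"
  obtain k' r' where kr': "foldr (push w) u (0, []) = (k', r')"
    by fastforce
  note IH = Cons.IH[OF kr']
  have r': "r' \<in> lists (set w)"
    using word_cong_in_lists[OF IH] by auto
  have D: "?D j \<in> lists (set w)" for j
    by (induction j) auto
  \<comment> \<open>Powers of a central element are central.\<close>
  have Dc: "(v @ ?D j, ?D j @ v) \<in> ?C" if "v \<in> lists (set w)" for v j
  proof (induction j)
    case 0
    then show ?case using that by (auto intro: word_cong.refl)
  next
    case (Suc j)
    have "((v @ w) @ ?D j, (w @ v) @ ?D j) \<in> ?C"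
      by (rule word_cong.append[OF cyclic_word_central[OF that] word_cong.refl[OF D]])
    moreover have "(w @ v @ ?D j, w @ ?D j @ v) \<in> ?C"
      by (rule word_cong.append[OF word_cong.refl Suc]) auto
    ultimately show ?case by (auto intro: word_cong.trans)
  qed
  have x: "[x] \<in> lists (set w)"
    using Cons.hyps by simp
  have "([x] @ u, [x] @ ?D k' @ r') \<in> ?C"
    by (rule word_cong.append[OF word_cong.refl[OF x] IH])
  moreover have "(([x] @ ?D k') @ r', (?D k' @ [x]) @ r') \<in> ?C"
    by (rule word_cong.append[OF Dc[OF x] word_cong.refl[OF r']])
  ultimately have step: "(x # u, ?D k' @ x # r') \<in> ?C"
    by (auto intro: word_cong.trans)
  show ?case
  proof (cases "take (length w) (x # r') \<in> rotations w")
    case False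
    then show ?thesis
      using Cons.prems kr' step by simp
  next
    case True
    let ?z = "take (length w) (x # r')"
    have eq: "k = Suc k'" "r = drop (length w) (x # r')"
      using True Cons.prems kr' by auto
    have r: "r \<in> lists (set w)"
      using r' x eq by (metis append_Cons append_Nil append_in_lists_conv append_take_drop_id)
    have "(?D k' @ ?z @ r, ?D k' @ w @ r) \<in> ?C"
      by (rule word_cong_context[OF rotations_cong[OF True] D r])
    moreover have "?z @ r = x # r'"
      by (simp add: eq)
    moreover have "?D k' @ w @ r = ?D k @ r"
      unfolding eq by (induction k') auto
    ultimately show ?thesis
      using step by (auto intro: word_cong.trans)
  qed
qed

text \<open>Multiplying by \<open>w\<close> raises the exponent of the normal form by one and keeps
  its reduced word. Hence \<open>u\<close> and \<open>v\<close> have the same normal form, and each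
  is congruent to it.\<close>

lemma cyclic_word_left_cancel:
  assumes "distinct w" "w \<noteq> []" "u \<in> lists (set w)" "v \<in> lists (set w)"
    "(w @ u, w @ v) \<in> word_cong (set w) (cyclic_rels w)"
  shows "(u, v) \<in> word_cong (set w) (cyclic_rels w)"
proof -
  obtain k r k' r' where nf: "foldr (push w) u (0, []) = (k, r)" "foldr (push w) v (0, []) = (k', r')"
    by fastforce
  have red: "reduced w r" "reduced w r'"
    using reduced_foldr_push[of w "(0, [])"] reduced_Nil[OF assms(2)] nf by (metis snd_conv)+
  have "foldr (push w) (w @ u) (0, []) = foldr (push w) (w @ v) (0, [])"
    using foldr_push_cong[OF assms(1,2,5)] reduced_Nil[OF assms(2)] by simp
  then have "(k, r) = (k', r')"
    using foldr_push_rotation[OF assms(1,2) self_in_rotations] red nf by simp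
  then show ?thesis
    using foldr_push_normal_form[OF assms(3) nf(1)] foldr_push_normal_form[OF assms(4) nf(2)]
    by (auto intro: word_cong.trans word_cong.sym)
qed

text \<open>A leading letter \<open>x\<close> is completed to \<Delta> by multiplying with its
  cofactor on the left; then \<Delta> is cancelled.\<close>

lemma cyclic_left_cancel:
  assumes "distinct w" "(a @ u, a @ v) \<in> word_cong (set w) (cyclic_rels w)"
  shows "(u, v) \<in> word_cong (set w) (cyclic_rels w)"
  using assms(2)
proof (induction a)
  case Nil
  then show ?case by simp
next
  case (Cons x a)
  let ?C = "word_cong (set w) (cyclic_rels w)"
  have in_lists: "x # a @ u \<in> lists (set w)" "x # a @ v \<in> lists (set w)"
    using word_cong_in_lists[OF Cons.prems] by auto
  then obtain y where y: "y @ [x] \<in> rotations w"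
    by (metis lists.simps list.discI list.inject rotation_with_head)
  have "y \<in> lists (set w)"
    using set_rotations[OF y] by auto
  then have "(y @ x # a @ u, y @ x # a @ v) \<in> ?C"
    using Cons.prems by (auto intro: word_cong.append word_cong.refl)
  moreover have "((y @ [x]) @ b, w @ b) \<in> ?C" if "b \<in> lists (set w)" for b
    by (rule word_cong.append[OF rotations_cong[OF y] word_cong.refl[OF that]])
  from this[of "a @ u"] this[of "a @ v"]
  have "(y @ x # a @ u, w @ a @ u) \<in> ?C" "(y @ x # a @ v, w @ a @ v) \<in> ?C"
    using in_lists by auto
  ultimately have "(w @ a @ u, w @ a @ v) \<in> ?C"
    by (meson word_cong.trans word_cong.sym)
  then have "(a @ u, a @ v) \<in> ?C"
    by (rule cyclic_word_left_cancel[OF assms(1), rotated -1]) (use in_lists in auto)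
  then show ?case by (rule Cons.IH)
qed

text \<open>A last letter is completed to \<Delta> on the right; by centrality \<Delta> moves to the
  front, where left cancellation applies.\<close>

lemma cyclic_right_cancel:
  assumes "distinct w" "(u @ b, v @ b) \<in> word_cong (set w) (cyclic_rels w)"
  shows "(u, v) \<in> word_cong (set w) (cyclic_rels w)"
  using assms(2)
proof (induction b rule: rev_induct)
  case Nil
  then show ?case by simp
next
  case (snoc x b)
  let ?C = "word_cong (set w) (cyclic_rels w)"
  have in_lists: "u @ b @ [x] \<in> lists (set w)" "v @ b @ [x] \<in> lists (set w)"
    using word_cong_in_lists[OF snoc.prems] by auto
  then have "x \<in> set w" by auto
  then obtain y where y: "x # y \<in> rotations w"
    by (meson rotation_with_head)
  have yl: "y \<in> lists (set w)"
    using set_rotations[OF y] by auto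
  have *: "(a @ x # y, w @ a) \<in> ?C" if "a \<in> lists (set w)" for a
    using word_cong.append[OF word_cong.refl[OF that] rotations_cong[OF y]]
      cyclic_word_central[OF that] by (rule word_cong.trans)
  have "((u @ b @ [x]) @ y, (v @ b @ [x]) @ y) \<in> ?C"
    using yl by (intro word_cong.append[OF _ word_cong.refl] snoc.prems) auto
  moreover have "((u @ b) @ x # y, w @ u @ b) \<in> ?C" "((v @ b) @ x # y, w @ v @ b) \<in> ?C"
    using *[of "u @ b"] *[of "v @ b"] in_lists by auto
  ultimately have "(w @ u @ b, w @ v @ b) \<in> ?C"
    by (auto intro: word_cong.trans word_cong.sym)
  then have "(u @ b, v @ b) \<in> ?C"
    by (rule cyclic_left_cancel[OF assms(1)])
  then show ?case by (rule snoc.IH)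
qed

section \<open>Two presentations sharing one letter\<close>

lemma filter_eq_appendD:
  "filter F v = c @ d \<Longrightarrow> \<exists>a b. v = a @ b \<and> filter F a = c \<and> filter F b = d"
proof (induction v arbitrary: c)
  case Nil
  then show ?case by simp
next
  case (Cons x v)
  show ?case
  proof (cases "F x \<and> c \<noteq> []")
    case True
    then obtain c' where c': "c = x # c'" "filter F v = c' @ d"
      using Cons.prems by (cases c) auto
    then obtain a b where "v = a @ b \<and> filter F a = c' \<and> filter F b = d"
      using Cons.IH by blast
    then show ?thesis
      using True c' by (intro exI[of _ "x # a"] exI[of _ b]) simp
  next
    case False
    show ?thesis
    proof (cases "F x")
      case True
      then show ?thesis
        using False Cons.prems by (intro exI[of _ "[]"] exI[of _ "x # v"]) simp
    next
      case not_F: False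
      then obtain a b where "v = a @ b \<and> filter F a = c \<and> filter F b = d"
        using Cons.IH[of c] Cons.prems by auto
      then show ?thesis
        using not_F by (intro exI[of _ "x # a"] exI[of _ b]) simp
    qed
  qed
qed

lemma append_Cons_first_eqD:
  assumes "xs @ x # ys = xs' @ x # ys'" "x \<notin> set xs" "x \<notin> set xs'"
  shows "xs = xs' \<and> ys = ys'"
  using assms
proof (induction xs arbitrary: xs')
  case Nil
  then show ?case by (cases xs') simp_all
next
  case (Cons y xs)
  then show ?case by (cases xs') simp_all
qed

text \<open>\<open>P\<close> and \<open>Q\<close> model the \<open>t\<close>- and the
  \<open>u\<close>-letters. On words over \<open>X\<close>, filtering by \<open>x \<notin> Q\<close>
  keeps \<open>s\<close> and \<open>P\<close>, and filtering by \<open>x \<notin> P\<close> keeps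
  \<open>s\<close> and \<open>Q\<close>; these are the two projections. The assumptions are
  symmetric in \<open>P\<close> and \<open>Q\<close>, so every result can also be used with the
  roles exchanged.\<close>

locale shared_letter =
  fixes X :: "'a set" and R :: "('a list \<times> 'a list) set" and s :: 'a and P Q :: "'a set"
  assumes X: "X = insert s (P \<union> Q)"
    and s_notin: "s \<notin> P" "s \<notin> Q"
    and disjoint: "P \<inter> Q = {}"
    and commute: "\<And>p q. p \<in> P \<Longrightarrow> q \<in> Q \<Longrightarrow> ([p, q], [q, p]) \<in> word_cong X R"
begin

lemma shared_letter_swap: "shared_letter X R s Q P"
proof
  show "([p, q], [q, p]) \<in> word_cong X R" if "p \<in> Q" "q \<in> P" for p q
    by (rule word_cong.sym[OF commute[OF that(2,1)]])
qed (use X s_notin disjoint in auto)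

section \<open>Recovering a word from its two projections\<close>

lemma commute_letter:
  assumes "q \<in> Q" "v \<in> lists P"
  shows "(q # v, v @ [q]) \<in> word_cong X R"
  using assms(2)
proof (induction v)
  case Nil
  then show ?case using assms(1) X by (auto intro: word_cong.refl)
next
  case (Cons p v)
  have "([q, p] @ v, [p, q] @ v) \<in> word_cong X R"
    using Cons.hyps X
    by (intro word_cong.append word_cong.refl word_cong.sym[OF commute] assms(1)) auto
  moreover have "([p] @ q # v, [p] @ v @ [q]) \<in> word_cong X R"
    using Cons.hyps X by (intro word_cong.append word_cong.refl Cons.IH) auto
  ultimately show ?case by simp (erule (1) word_cong.trans)
qed

text \<open>In the absence of \<open>s\<close>, each \<open>Q\<close>-letter can be moved right past
  all \<open>P\<close>-letters, and the two filters are exactly the \<open>P\<close>-part and the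
  \<open>Q\<close>-part.\<close>

lemma separate:
  assumes "v \<in> lists (P \<union> Q)"
  shows "(v, filter (\<lambda>x. x \<notin> Q) v @ filter (\<lambda>x. x \<notin> P) v) \<in> word_cong X R"
  using assms
proof (induction v)
  case Nil
  then show ?case by (auto intro: word_cong.refl)
next
  case (Cons x v)
  let ?p = "filter (\<lambda>x. x \<notin> Q) v" and ?q = "filter (\<lambda>x. x \<notin> P) v"
  have "([x] @ v, [x] @ ?p @ ?q) \<in> word_cong X R"
    using Cons.hyps X by (intro word_cong.append word_cong.refl Cons.IH) auto
  moreover have "((x # ?p) @ ?q, (?p @ [x]) @ ?q) \<in> word_cong X R" if "x \<in> Q"
    using Cons.hyps that X by (intro word_cong.append word_cong.refl commute_letter) auto
  ultimately show ?case
    using Cons.hyps disjoint by (cases "x \<in> Q") (auto elim: word_cong.trans)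
qed

text \<open>The letter \<open>s\<close> survives both projections, so cutting at its first
  occurrence cuts both projections accordingly. The pieces are shorter words with equal projections;
  words without \<open>s\<close> are settled by \<open>separate\<close>.\<close>

lemma projections_jointly_injective:
  assumes "v \<in> lists X" "v' \<in> lists X"
    "filter (\<lambda>x. x \<notin> Q) v = filter (\<lambda>x. x \<notin> Q) v'"
    "filter (\<lambda>x. x \<notin> P) v = filter (\<lambda>x. x \<notin> P) v'"
  shows "(v, v') \<in> word_cong X R"
  using assms
proof (induction "length v" arbitrary: v v' rule: less_induct)
  case less
  have s_iff: "s \<in> set v \<longleftrightarrow> s \<in> set v'"
    using arg_cong[OF less.prems(3), of "\<lambda>xs. s \<in> set xs"] s_notin by simp
  show ?case
  proof (cases "s \<in> set v")
    case False
    then have "v \<in> lists (P \<union> Q)" "v' \<in> lists (P \<union> Q)"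
      using less.prems(1,2) s_iff X by auto
    then show ?thesis
      using separate[of v] separate[of v'] less.prems(3,4) by (metis word_cong.sym word_cong.trans)
  next
    case True
    then obtain a b where ab: "v = a @ s # b" "s \<notin> set a"
      by (meson split_list_first)
    obtain a' b' where ab': "v' = a' @ s # b'" "s \<notin> set a'"
      using True s_iff by (meson split_list_first)
    have first: "filter F a = filter F a' \<and> filter F b = filter F b'"
      if "filter F v = filter F v'" "F s" for F
      using that ab ab' by (intro append_Cons_first_eqD[where x = s]) auto
    have proj: "filter (\<lambda>x. x \<notin> Q) a = filter (\<lambda>x. x \<notin> Q) a' \<and>
        filter (\<lambda>x. x \<notin> Q) b = filter (\<lambda>x. x \<notin> Q) b'"
      "filter (\<lambda>x. x \<notin> P) a = filter (\<lambda>x. x \<notin> P) a' \<and>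
        filter (\<lambda>x. x \<notin> P) b = filter (\<lambda>x. x \<notin> P) b'"
      using first less.prems(3,4) s_notin by blast+
    have "(a, a') \<in> word_cong X R" "(b, b') \<in> word_cong X R"
      using less.prems(1,2) ab ab' proj by (auto intro!: less.hyps)
    moreover have "([s], [s]) \<in> word_cong X R"
      using X by (auto intro: word_cong.refl)
    ultimately have "(a @ [s] @ b, a' @ [s] @ b') \<in> word_cong X R"
      by (intro word_cong.append)
    then show ?thesis using ab ab' by simp
  qed
qed

text \<open>Let \<open>v = a @ s # b\<close> with its only \<open>s\<close> displayed. The
  \<open>Q\<close>-letters of \<open>a\<close> move to the far left and those of \<open>b\<close> to
  the far right, leaving \<open>c\<close> as a contiguous factor to be replaced by \<open>d\<close>.
  As \<open>d\<close> also contains just one \<open>s\<close>, the \<open>Q\<close>-projection is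
  unchanged.\<close>

lemma lift_relation:
  assumes "(c, d) \<in> word_cong X R" "c \<in> lists (insert s P)" "d \<in> lists (insert s P)"
    "filter (\<lambda>x. x \<notin> P) c = [s]" "filter (\<lambda>x. x \<notin> P) d = [s]"
    "v \<in> lists X" "filter (\<lambda>x. x \<notin> Q) v = c"
  shows "\<exists>v'. (v, v') \<in> word_cong X R \<and> filter (\<lambda>x. x \<notin> Q) v' = d \<and>
    filter (\<lambda>x. x \<notin> P) v' = filter (\<lambda>x. x \<notin> P) v"
proof -
  interpret swap: shared_letter X R s Q P
    by (rule shared_letter_swap)
  let ?p = "filter (\<lambda>x. x \<notin> Q)" and ?q = "filter (\<lambda>x. x \<notin> P)"
  \<comment> \<open>On words over \<open>insert s P\<close>, lying outside \<open>P\<close> means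
    being \<open>s\<close>. Deleting \<open>Q\<close>-letters keeps every \<open>s\<close>, so
    \<open>v\<close> has as many as \<open>c\<close>.\<close>
  have fc: "filter (\<lambda>x. x = s) c = [s]"
    using assms(2,4) s_notin by (metis (mono_tags, lifting) filter_cong in_lists_conv_set insert_iff)
  have "filter (\<lambda>x. x = s) v = [s]"
    unfolding fc[symmetric] assms(7)[symmetric] filter_filter
    using s_notin by (intro filter_cong) auto
  then obtain a b where v: "v = a @ s # b" "\<forall>x\<in>set a. x \<noteq> s" "[] = filter (\<lambda>x. x = s) b"
    by (auto simp: filter_eq_Cons_iff)
  then have ab: "v = a @ s # b" "s \<notin> set a" "s \<notin> set b"
    using v(3)[symmetric] by (auto simp: filter_empty_conv)
  have c: "c = ?p a @ s # ?p b"
    using assms(7) ab s_notin by simp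
  have abl: "a \<in> lists (P \<union> Q)" "b \<in> lists (P \<union> Q)"
    using assms(6) ab X by auto
  have sX: "([s], [s]) \<in> word_cong X R"
    using X by (auto intro: word_cong.refl)
  \<comment> \<open>The exchanged form of \<open>separate\<close> puts the \<open>Q\<close>-letters
    first in \<open>a\<close>; the original form puts them last in \<open>b\<close>.\<close>
  have "(a @ [s] @ b, (?q a @ ?p a) @ [s] @ (?p b @ ?q b)) \<in> word_cong X R"
    using abl by (intro word_cong.append sX separate swap.separate) auto
  moreover have "(?q a @ c @ ?q b, ?q a @ d @ ?q b) \<in> word_cong X R"
    using assms(6) ab by (intro word_cong_context assms(1)) auto
  ultimately have "(v, ?q a @ d @ ?q b) \<in> word_cong X R"
    using ab c by (auto intro: word_cong.trans)
  moreover have "?p (?q a) = []" "?p (?q b) = []"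
    using abl by (auto simp: filter_empty_conv)
  moreover have "?p d = d"
    using assms(3) s_notin disjoint by (auto simp: filter_id_conv)
  ultimately show ?thesis
    using ab assms(5) s_notin by (intro exI[of _ "?q a @ d @ ?q b"]) auto
qed

text \<open>A derivation between \<open>P\<close>-projections lifts to the big monoid without
  disturbing the \<open>Q\<close>-projection. Both directions are proved together so that the
  symmetry case of the induction goes through.\<close>

lemma lift_congruence:
  assumes "(c, d) \<in> word_cong (insert s P) S"
    and S: "\<And>c d. (c, d) \<in> S \<Longrightarrow> (c, d) \<in> word_cong X R"
    and one_s: "\<And>c d. (c, d) \<in> S \<Longrightarrow>
      filter (\<lambda>x. x \<notin> P) c = [s] \<and> filter (\<lambda>x. x \<notin> P) d = [s]"
  shows "(\<forall>v\<in>lists X. filter (\<lambda>x. x \<notin> Q) v = c \<longrightarrow> (\<exists>v'. (v, v') \<in> word_cong X R \<and>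
      filter (\<lambda>x. x \<notin> Q) v' = d \<and> filter (\<lambda>x. x \<notin> P) v' = filter (\<lambda>x. x \<notin> P) v)) \<and>
    (\<forall>v\<in>lists X. filter (\<lambda>x. x \<notin> Q) v = d \<longrightarrow> (\<exists>v'. (v, v') \<in> word_cong X R \<and>
      filter (\<lambda>x. x \<notin> Q) v' = c \<and> filter (\<lambda>x. x \<notin> P) v' = filter (\<lambda>x. x \<notin> P) v))"
    (is "?L c d \<and> ?L d c")
  using assms(1)
proof (induction rule: word_cong.induct)
  case (rel c d)
  note cd = S[OF rel(1)] and one = one_s[OF rel(1)]
  show ?case
    using lift_relation[OF cd rel(2,3)] lift_relation[OF word_cong.sym[OF cd] rel(3,2)] one by blast
next
  case (refl c)
  then show ?case by (blast intro: word_cong.refl)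
next
  case (sym c d)
  then show ?case by blast
next
  case (trans c d e)
  have trans_L: "?L c e" if "?L c d" "?L d e" for c d e
  proof (intro ballI impI)
    fix v assume "v \<in> lists X" "filter (\<lambda>x. x \<notin> Q) v = c"
    then obtain v' where v': "(v, v') \<in> word_cong X R" "filter (\<lambda>x. x \<notin> Q) v' = d"
        "filter (\<lambda>x. x \<notin> P) v' = filter (\<lambda>x. x \<notin> P) v"
      using \<open>?L c d\<close> by blast
    then have "v' \<in> lists X"
      using word_cong_in_lists by metis
    then obtain v'' where "(v', v'') \<in> word_cong X R" "filter (\<lambda>x. x \<notin> Q) v'' = e"
        "filter (\<lambda>x. x \<notin> P) v'' = filter (\<lambda>x. x \<notin> P) v'"
      using \<open>?L d e\<close> v'(2) by blast
    then show "\<exists>v'. (v, v') \<in> word_cong X R \<and> filter (\<lambda>x. x \<notin> Q) v' = e \<and>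
        filter (\<lambda>x. x \<notin> P) v' = filter (\<lambda>x. x \<notin> P) v"
      using v' by (metis word_cong.trans)
  qed
  show ?case
    using trans_L[of c d e] trans_L[of e d c] trans.IH by blast
next
  case (append c d c' d')
  \<comment> \<open>A split of the projection is induced by a split of \<open>v\<close>, so the two
    factors lift independently.\<close>
  have append_L: "?L (c @ c') (d @ d')" if "?L c d" "?L c' d'" for c d c' d'
  proof (intro ballI impI)
    fix v assume v: "v \<in> lists X" "filter (\<lambda>x. x \<notin> Q) v = c @ c'"
    then obtain a b where ab: "v = a @ b" "filter (\<lambda>x. x \<notin> Q) a = c" "filter (\<lambda>x. x \<notin> Q) b = c'"
      by (blast dest: filter_eq_appendD)
    obtain a' where "(a, a') \<in> word_cong X R" "filter (\<lambda>x. x \<notin> Q) a' = d"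
        "filter (\<lambda>x. x \<notin> P) a' = filter (\<lambda>x. x \<notin> P) a"
      using \<open>?L c d\<close> v ab by auto
    moreover obtain b' where "(b, b') \<in> word_cong X R" "filter (\<lambda>x. x \<notin> Q) b' = d'"
        "filter (\<lambda>x. x \<notin> P) b' = filter (\<lambda>x. x \<notin> P) b"
      using \<open>?L c' d'\<close> v ab by auto
    ultimately show "\<exists>v'. (v, v') \<in> word_cong X R \<and> filter (\<lambda>x. x \<notin> Q) v' = d @ d' \<and>
        filter (\<lambda>x. x \<notin> P) v' = filter (\<lambda>x. x \<notin> P) v"
      using ab by (intro exI[of _ "a' @ b'"]) (auto intro: word_cong.append)
  qed
  show ?case
    using append_L[of c d c' d'] append_L[of d c d' c'] append.IH by blast
qed

text \<open>Correct the \<open>P\<close>-projection of \<open>v\<close> first, then the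
  \<open>Q\<close>-projection; neither correction affects the other projection. The outcome has the
  same two projections as \<open>v'\<close>.\<close>

lemma word_cong_if_projections_cong:
  assumes "v \<in> lists X" "v' \<in> lists X"
    and P: "(filter (\<lambda>x. x \<notin> Q) v, filter (\<lambda>x. x \<notin> Q) v') \<in> word_cong (insert s P) S"
    and Q: "(filter (\<lambda>x. x \<notin> P) v, filter (\<lambda>x. x \<notin> P) v') \<in> word_cong (insert s Q) S'"
    and S: "\<And>c d. (c, d) \<in> S \<union> S' \<Longrightarrow> (c, d) \<in> word_cong X R"
    and one_s: "\<And>c d. (c, d) \<in> S \<Longrightarrow>
      filter (\<lambda>x. x \<notin> P) c = [s] \<and> filter (\<lambda>x. x \<notin> P) d = [s]"
    and one_s': "\<And>c d. (c, d) \<in> S' \<Longrightarrow>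
      filter (\<lambda>x. x \<notin> Q) c = [s] \<and> filter (\<lambda>x. x \<notin> Q) d = [s]"
  shows "(v, v') \<in> word_cong X R"
proof -
  interpret swap: shared_letter X R s Q P
    by (rule shared_letter_swap)
  obtain a where a: "(v, a) \<in> word_cong X R" "filter (\<lambda>x. x \<notin> Q) a = filter (\<lambda>x. x \<notin> Q) v'"
      "filter (\<lambda>x. x \<notin> P) a = filter (\<lambda>x. x \<notin> P) v"
    using lift_congruence[OF P S one_s] assms(1) by blast
  have al: "a \<in> lists X"
    using word_cong_in_lists[OF a(1)] by blast
  obtain b where b: "(a, b) \<in> word_cong X R" "filter (\<lambda>x. x \<notin> P) b = filter (\<lambda>x. x \<notin> P) v'"
      "filter (\<lambda>x. x \<notin> Q) b = filter (\<lambda>x. x \<notin> Q) a"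
    using swap.lift_congruence[OF Q S one_s'] al a(3) by blast
  have "(b, v') \<in> word_cong X R"
    using word_cong_in_lists[OF b(1)] assms(2) a b by (intro projections_jointly_injective) auto
  then show ?thesis
    using a(1) b(1) by (meson word_cong.trans)
qed

end

text \<open>Erasing letters is a homomorphism of free monoids, so only the defining relations have
  to be checked.\<close>

lemma word_cong_filter:
  assumes "(u, v) \<in> word_cong X R"
    and "\<And>u v. (u, v) \<in> R \<Longrightarrow> u \<in> lists X \<Longrightarrow> v \<in> lists X \<Longrightarrow>
      (filter F u, filter F v) \<in> word_cong Y S"
    and "{x \<in> X. F x} \<subseteq> Y"
  shows "(filter F u, filter F v) \<in> word_cong Y S"
  using assms(1)
proof (induction rule: word_cong.induct)
  case (refl u)
  then show ?case using assms(3) by (intro word_cong.refl) auto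
qed (auto intro: assms(2) word_cong.sym word_cong.trans word_cong.append)

section \<open>The monoid \<open>G\<^sub>m\<^sub>,\<^sub>n\<^sup>+\<close>\<close>

text \<open>Rotation changes neither the set of surviving letters nor distinctness, and a distinct
  list with set \<open>{x}\<close> is \<open>[x]\<close>.\<close>

lemma filter_rotate_singleton:
  assumes "distinct w" "filter F w = [x]"
  shows "filter F (rotate i w) = [x]"
proof -
  have "set (filter F (rotate i w)) = set (filter F w)"
    by simp
  then have x: "set (filter F (rotate i w)) = {x}"
    unfolding assms(2) by simp
  have "length (filter F (rotate i w)) = card (set (filter F (rotate i w)))"
    using assms(1) by (intro distinct_card[symmetric]) simp
  also have "\<dots> = Suc 0"
    unfolding x by simp
  finally obtain y where "filter F (rotate i w) = [y]"
    by (auto simp: length_Suc_conv)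
  then show ?thesis
    using x by simp
qed

lemma cyclic_rels_filter_singleton:
  assumes "distinct w" "filter F w = [x]" "(c, d) \<in> cyclic_rels w"
  shows "filter F c = [x] \<and> filter F d = [x]"
  using assms filter_rotate_singleton[OF assms(1,2)] by (auto simp: cyclic_rels_def)

lemma cyclic_rels_pair: "cyclic_rels [a, b] = {([a, b], [a, b]), ([a, b], [b, a])}"
  by (auto simp: cyclic_rels_def less_Suc_eq numeral_2_eq_2 intro: exI[of _ "Suc 0"] exI[of _ 0])

section \<open>The two projections of \<open>G_plus\<close>\<close>

context
  fixes m n :: nat
begin

abbreviation "t_word \<equiv> Gen_s # map Gen_t [1..<Suc m]"
abbreviation "u_word \<equiv> Gen_s # map Gen_u [1..<Suc n]"
abbreviation "t_gens \<equiv> Gen_t ` {1..m}"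
abbreviation "u_gens \<equiv> Gen_u ` {1..n}"
abbreviation "G_cong \<equiv> word_cong (G_gens m n) (G_rels m n)"

lemma distinct_gen_words: "distinct t_word" "distinct u_word"
  by (auto simp: distinct_map inj_on_def)

lemma set_gen_words: "set t_word = insert Gen_s t_gens" "set u_word = insert Gen_s u_gens"
  by (auto simp del: upt_Suc)

lemma G_rels_cases:
  assumes "(c, d) \<in> G_rels m n"
  obtains "(c, d) \<in> cyclic_rels t_word" | "(c, d) \<in> cyclic_rels u_word"
    | i j where "i \<in> {1..m}" "j \<in> {1..n}" "(c, d) \<in> cyclic_rels [Gen_t i, Gen_u j]"
  using assms unfolding G_rels_def by blast

lemma cyclic_rels_in_lists:
  assumes "(c, d) \<in> cyclic_rels w" "set w \<subseteq> X"
  shows "c \<in> lists X" "d \<in> lists X"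
  using assms by (auto simp: cyclic_rels_def)

lemma shared_letter_G: "shared_letter (G_gens m n) (G_rels m n) Gen_s t_gens u_gens"
proof
  fix p q assume "p \<in> t_gens" "q \<in> u_gens"
  then show "([p, q], [q, p]) \<in> G_cong"
    by (intro word_cong.rel) (auto simp: G_rels_def G_gens_def cyclic_rels_pair)
qed (auto simp: G_gens_def)

lemma filter_gen_words:
  "filter (\<lambda>x. x \<notin> t_gens) t_word = [Gen_s]" "filter (\<lambda>x. x \<notin> u_gens) u_word = [Gen_s]"
  by (auto simp: filter_empty_conv simp del: upt_Suc)

text \<open>Deleting the \<open>u\<close>-letters preserves the relations of \<open>t_word\<close>,
  turns those of \<open>u_word\<close> into \<open>s = s\<close>, and makes the commutation
  relations trivial.\<close>

lemma t_projection:
  assumes "(c, d) \<in> G_cong"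
  shows "(filter (\<lambda>x. x \<notin> u_gens) c, filter (\<lambda>x. x \<notin> u_gens) d)
    \<in> word_cong (set t_word) (cyclic_rels t_word)"
  using assms
proof (rule word_cong_filter)
  fix c d assume "(c, d) \<in> G_rels m n"
  then show "(filter (\<lambda>x. x \<notin> u_gens) c, filter (\<lambda>x. x \<notin> u_gens) d)
    \<in> word_cong (set t_word) (cyclic_rels t_word)"
  proof (cases rule: G_rels_cases)
    case 1
    have in_lists: "c \<in> lists (set t_word)" "d \<in> lists (set t_word)"
      by (rule cyclic_rels_in_lists[OF 1 subset_refl])+
    then have "filter (\<lambda>x. x \<notin> u_gens) c = c" "filter (\<lambda>x. x \<notin> u_gens) d = d"
      unfolding set_gen_words by (auto simp: filter_id_conv)
    then show ?thesis
      using word_cong.rel[OF 1 in_lists] by simp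
  next
    case 2
    then show ?thesis
      using cyclic_rels_filter_singleton[OF distinct_gen_words(2) filter_gen_words(2) 2]
      by (auto intro!: word_cong.refl simp del: upt_Suc)
  next
    case (3 i j)
    then have "filter (\<lambda>x. x \<notin> u_gens) c = [Gen_t i]" "filter (\<lambda>x. x \<notin> u_gens) d = [Gen_t i]"
      by (auto simp: cyclic_rels_pair)
    moreover have "[Gen_t i] \<in> lists (set t_word)"
      unfolding set_gen_words using 3 by simp
    ultimately show ?thesis
      by (simp only: word_cong.refl)
  qed
qed (auto simp: G_gens_def)

lemma u_projection:
  assumes "(c, d) \<in> G_cong"
  shows "(filter (\<lambda>x. x \<notin> t_gens) c, filter (\<lambda>x. x \<notin> t_gens) d)
    \<in> word_cong (set u_word) (cyclic_rels u_word)"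
  using assms
proof (rule word_cong_filter)
  fix c d assume "(c, d) \<in> G_rels m n"
  then show "(filter (\<lambda>x. x \<notin> t_gens) c, filter (\<lambda>x. x \<notin> t_gens) d)
    \<in> word_cong (set u_word) (cyclic_rels u_word)"
  proof (cases rule: G_rels_cases)
    case 1
    then show ?thesis
      using cyclic_rels_filter_singleton[OF distinct_gen_words(1) filter_gen_words(1) 1]
      by (auto intro!: word_cong.refl simp del: upt_Suc)
  next
    case 2
    have in_lists: "c \<in> lists (set u_word)" "d \<in> lists (set u_word)"
      by (rule cyclic_rels_in_lists[OF 2 subset_refl])+
    then have "filter (\<lambda>x. x \<notin> t_gens) c = c" "filter (\<lambda>x. x \<notin> t_gens) d = d"
      unfolding set_gen_words by (auto simp: filter_id_conv)
    then show ?thesis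
      using word_cong.rel[OF 2 in_lists] by simp
  next
    case (3 i j)
    then have "filter (\<lambda>x. x \<notin> t_gens) c = [Gen_u j]" "filter (\<lambda>x. x \<notin> t_gens) d = [Gen_u j]"
      by (auto simp: cyclic_rels_pair)
    moreover have "[Gen_u j] \<in> lists (set u_word)"
      unfolding set_gen_words using 3 by simp
    ultimately show ?thesis
      by (simp only: word_cong.refl)
  qed
qed (auto simp: G_gens_def)

text \<open>Cancel in both cyclic monoids after projecting, then recombine the two
  congruences.\<close>

lemma G_cong_cancel:
  assumes "(a @ x @ b, a @ y @ b) \<in> G_cong"
  shows "(x, y) \<in> G_cong"
proof -
  have xy: "x \<in> lists (G_gens m n)" "y \<in> lists (G_gens m n)"
    using word_cong_in_lists[OF assms] by auto
  \<comment> \<open>Removes the left factor first, then the right one.\<close>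
  note cancel = cyclic_right_cancel[OF _ cyclic_left_cancel]
  have t: "(filter (\<lambda>x. x \<notin> u_gens) x, filter (\<lambda>x. x \<notin> u_gens) y)
      \<in> word_cong (insert Gen_s t_gens) (cyclic_rels t_word)"
    using t_projection[OF assms] cancel[OF distinct_gen_words(1,1)]
    unfolding filter_append set_gen_words by blast
  have u: "(filter (\<lambda>x. x \<notin> t_gens) x, filter (\<lambda>x. x \<notin> t_gens) y)
      \<in> word_cong (insert Gen_s u_gens) (cyclic_rels u_word)"
    using u_projection[OF assms] cancel[OF distinct_gen_words(2,2)]
    unfolding filter_append set_gen_words by blast
  show ?thesis
  proof (rule shared_letter.word_cong_if_projections_cong[OF shared_letter_G xy t u])
    fix c d assume cd: "(c, d) \<in> cyclic_rels t_word \<union> cyclic_rels u_word"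
    have "set t_word \<subseteq> G_gens m n" "set u_word \<subseteq> G_gens m n"
      unfolding set_gen_words by (auto simp: G_gens_def)
    then have "c \<in> lists (G_gens m n)" "d \<in> lists (G_gens m n)"
      using cd cyclic_rels_in_lists[of c d _ "G_gens m n"] by (metis UnE)+
    then show "(c, d) \<in> G_cong"
      using cd by (intro word_cong.rel) (auto simp: G_rels_def)
  qed (rule cyclic_rels_filter_singleton[OF distinct_gen_words(1) filter_gen_words(1)]
      cyclic_rels_filter_singleton[OF distinct_gen_words(2) filter_gen_words(2)]; assumption)+
qed

end

theorem theorem4p1:
  fixes m n :: nat
  assumes "m \<ge> 2" and "n \<ge> 2"
  shows "\<forall>A \<in> carrier (G_plus m n). \<forall>B \<in> carrier (G_plus m n).
         \<forall>X \<in> carrier (G_plus m n). \<forall>Y \<in> carrier (G_plus m n).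
           A \<otimes>\<^bsub>G_plus m n\<^esub> X \<otimes>\<^bsub>G_plus m n\<^esub> B = A \<otimes>\<^bsub>G_plus m n\<^esub> Y \<otimes>\<^bsub>G_plus m n\<^esub> B
           \<longrightarrow> X = Y"
proof (intro ballI impI)
  let ?X = "G_gens m n" and ?R = "G_rels m n"
  let ?c = "\<lambda>v. word_cong ?X ?R `` {v}"
  note mult = presented_monoid_mult_class[of _ ?X _ ?R]
  fix A B X Y
  assume carr: "A \<in> carrier (G_plus m n)" "B \<in> carrier (G_plus m n)"
      "X \<in> carrier (G_plus m n)" "Y \<in> carrier (G_plus m n)"
    and eq: "A \<otimes>\<^bsub>G_plus m n\<^esub> X \<otimes>\<^bsub>G_plus m n\<^esub> B = A \<otimes>\<^bsub>G_plus m n\<^esub> Y \<otimes>\<^bsub>G_plus m n\<^esub> B"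
  have "\<exists>v\<in>lists ?X. Z = ?c v" if "Z \<in> carrier (G_plus m n)" for Z
    using that unfolding G_plus_def presented_monoid_def quotient_def by auto
  then obtain a b x y where abxy: "a \<in> lists ?X" "A = ?c a" "b \<in> lists ?X" "B = ?c b"
      "x \<in> lists ?X" "X = ?c x" "y \<in> lists ?X" "Y = ?c y"
    using carr by meson
  \<comment> \<open>With chosen representatives, products of classes are classes of concatenations,
    which reduces the claim to words.\<close>
  have "?c (a @ x @ b) = ?c (a @ y @ b)"
    using eq abxy mult[of a x] mult[of a y] mult[of "a @ x" b] mult[of "a @ y" b]
    by (simp add: G_plus_def)
  then have "(a @ x @ b, a @ y @ b) \<in> word_cong ?X ?R"
    using abxy by (subst (asm) eq_equiv_class_iff[OF equiv_word_cong]) auto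
  then have "(x, y) \<in> word_cong ?X ?R"
    by (rule G_cong_cancel)
  then show "X = Y"
    using abxy equiv_class_eq[OF equiv_word_cong] by blast
qed

end
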